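(* Let $x,y,s,t$ be complex numbers with $\max\{|s|,|t|,|sx|,|tx|\}<1$. Then $$\sum_{n=0}^{\infty}\sum_{m=0}^{\infty}h_{m+n}(x,y|q)\frac{t^n}{(q;q)_n}\frac{s^m}{(q;q)_m}=\frac{(ty;q)_\infty}{(s,t,tx;q)_\infty}\;{}_{2}\phi_1\left[\begin{array}{c}t,\ y/x\\ ty\end{array};q,sx\right].$$
   Context: Let $|q|<1$. The $q$-shifted factorials are $(x;q)_\infty=\prod_{k=0}^{\infty}(1-xq^k)$ and $(x;q)_n=(x;q)_\infty/(xq^n;q)_\infty$, with $(x_1,\ldots,x_m;q)_n=(x_1;q)_n\cdots(x_m;q)_n$ for $n$ an integer or $\infty$. The $q$-binomial coefficients are ${n \brack k}=\frac{(q;q)_n}{(q;q)_k(q;q)_{n-k}}$. The basic hypergeometric series ${}_2\phi_1$ is ${}_{2}\phi_1\left[\begin{array}{c}a_1,a_2\\ b_1\end{array};q,z\right]=\sum_{k=0}^\infty\frac{(a_1,a_2;q)_k}{(q,b_1;q)_k}z^k$. The bivariate Rogers-Szeg\"o polynomials are $$h_n(x,y|q)=\sum_{k=0}^{n}{n \brack k}P_k(x,y),\qquad P_k(x,y)=x^k(y/x;q)_k=(x-y)(x-qy)\cdots(x-q^{k-1}y).$$ As is standard for basic hypergeometric series, parameters are assumed to be such that no denominator vanishes (in particular $x\neq0$). *)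

theory Defs
  imports "HOL-Analysis.Analysis"
begin

definition qpoch_inf :: "complex \<Rightarrow> complex \<Rightarrow> complex" where
  "qpoch_inf a q = (\<Prod>k. 1 - a * q ^ k)"

(* The finite q-shifted factorial (a;q)_n for a natural number n. The quotient
   (a;q)_infinity / (a q^n;q)_infinity is 0/0 when a = q^(-m) with m >= n, so the
   standard finite product is taken as the definition; qpoch_eq_quotient below shows
   that it is the quotient whenever the quotient makes sense. *)
definition qpoch :: "complex \<Rightarrow> complex \<Rightarrow> nat \<Rightarrow> complex" where
  "qpoch a q n = (\<Prod>k<n. 1 - a * q ^ k)"

(* Intended for k <= n only: n - k is truncated subtraction. *)
definition qbinom :: "complex \<Rightarrow> nat \<Rightarrow> nat \<Rightarrow> complex" where
  "qbinom q n k = qpoch q q n / (qpoch q q k * qpoch q q (n - k))"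

definition P_poly :: "complex \<Rightarrow> nat \<Rightarrow> complex \<Rightarrow> complex \<Rightarrow> complex" where
  "P_poly q k x y = (\<Prod>i<k. x - q ^ i * y)"

(* The bivariate Rogers-Szego polynomial h_n(x,y|q). *)
definition rogers_szego :: "complex \<Rightarrow> nat \<Rightarrow> complex \<Rightarrow> complex \<Rightarrow> complex" where
  "rogers_szego q n x y = (\<Sum>k\<le>n. qbinom q n k * P_poly q k x y)"

definition phi21_term ::
  "complex \<Rightarrow> complex \<Rightarrow> complex \<Rightarrow> complex \<Rightarrow> complex \<Rightarrow> nat \<Rightarrow> complex" where
  "phi21_term a1 a2 b1 q z k =
     (qpoch a1 q k * qpoch a2 q k) / (qpoch q q k * qpoch b1 q k) * z ^ k"

(* Argument order as in the bracket notation: upper a1, a2; lower b1; base q; argument z. *)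
definition phi21 ::
  "complex \<Rightarrow> complex \<Rightarrow> complex \<Rightarrow> complex \<Rightarrow> complex \<Rightarrow> complex" where
  "phi21 a1 a2 b1 q z = (\<Sum>k. phi21_term a1 a2 b1 q z k)"

lemma qpoch_inf_convergent:
  fixes a q :: complex
  assumes "norm q < 1"
  shows "convergent_prod (\<lambda>k. 1 - a * q ^ k)"
proof -
  have "summable (\<lambda>k. norm a * norm q ^ k)"
    using assms by (intro summable_mult summable_geometric) simp
  then have "abs_convergent_prod (\<lambda>k. 1 - a * q ^ k)"
    by (simp add: abs_convergent_prod_conv_summable norm_mult norm_power)
  then show ?thesis by (rule abs_convergent_prod_imp_convergent_prod)
qed

lemma qpoch_inf_split:
  assumes "norm q < 1"
  shows "qpoch_inf a q = qpoch a q n * qpoch_inf (a * q ^ n) q"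
proof -
  have "(\<lambda>k. 1 - a * q ^ k) has_prod
      ((\<Prod>k<n. 1 - a * q ^ k) * (\<Prod>k. 1 - a * q ^ (k + n)))"
    by (rule has_prod_ignore_initial_segment') (rule qpoch_inf_convergent[OF assms])
  from has_prod_unique[OF this] show ?thesis
    by (simp add: qpoch_inf_def qpoch_def power_add mult_ac)
qed

lemma qpoch_eq_quotient:
  assumes "norm q < 1" and "qpoch_inf (a * q ^ n) q \<noteq> 0"
  shows "qpoch a q n = qpoch_inf a q / qpoch_inf (a * q ^ n) q"
  using qpoch_inf_split[OF assms(1), of a n] assms(2) by simp

lemma P_poly_eq_qpoch:
  assumes "x \<noteq> 0"
  shows "P_poly q k x y = x ^ k * qpoch (y / x) q k"
proof (induction k)
  case (Suc k)
  have "x - q ^ k * y = x * (1 - y / x * q ^ k)"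
    using assms by (simp add: field_simps)
  with Suc show ?case by (simp add: P_poly_def qpoch_def mult_ac)
qed (simp add: P_poly_def qpoch_def)

lemma qpoch_self_nonzero:
  assumes "norm q < 1"
  shows "qpoch q q n \<noteq> 0"
proof -
  have "q * q ^ k \<noteq> 1" for k
  proof
    assume "q * q ^ k = 1"
    then have "norm q ^ Suc k = 1" by (metis norm_one norm_power power_Suc)
    moreover have "norm q ^ Suc k \<le> norm q"
      using assms by (simp add: mult_left_le power_le_one)
    ultimately show False using assms by simp
  qed
  then show ?thesis unfolding qpoch_def by (auto simp: eq_commute[of 1])
qed

lemma summable_phi21_term:
  assumes q: "norm q < 1" and z: "norm z < 1" and nz: "\<And>k. qpoch b1 q k \<noteq> 0"
  shows "summable (phi21_term a1 a2 b1 q z)"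
proof -
  define r where
    "r k = (1 - a1 * q ^ k) * (1 - a2 * q ^ k) / ((1 - q * q ^ k) * (1 - b1 * q ^ k)) * z" for k
  have "(\<lambda>k. q ^ k) \<longlonglongrightarrow> 0" using q by (rule LIMSEQ_power_zero)
  then have "r \<longlonglongrightarrow> (1 - a1 * 0) * (1 - a2 * 0) / ((1 - q * 0) * (1 - b1 * 0)) * z"
    unfolding r_def using q by (intro tendsto_intros) auto
  then have "(\<lambda>k. norm (r k)) \<longlonglongrightarrow> norm z" using tendsto_norm by fastforce
  moreover obtain c where c: "norm z < c" "c < 1" using z dense by blast
  ultimately have "eventually (\<lambda>k. norm (r k) < c) sequentially"
    by (simp add: order_tendsto_iff)
  then obtain N where N: "\<And>k. k \<ge> N \<Longrightarrow> norm (r k) < c"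
    by (auto simp: eventually_sequentially)
  have step: "phi21_term a1 a2 b1 q z (Suc k) = r k * phi21_term a1 a2 b1 q z k" for k
    by (simp add: phi21_term_def qpoch_def r_def mult_ac)
  show ?thesis
  proof (rule summable_ratio_test[OF c(2)])
    fix k assume "k \<ge> N"
    then show "norm (phi21_term a1 a2 b1 q z (Suc k)) \<le> c * norm (phi21_term a1 a2 b1 q z k)"
      unfolding step norm_mult using N[of k] by (intro mult_right_mono) auto
  qed
qed

end

theory Submission
  imports Defs
begin

text \<open>
  Write \<open>h\<^sub>n\<close> for \<^term>\<open>rogers_szego q n x y\<close>, \<open>P\<^sub>k\<close> for \<^term>\<open>P_poly q k x y\<close>, and
  \<open>(a)\<^sub>n\<close>, \<open>(a)\<^sub>\<infinity>\<close> for the \<open>q\<close>-shifted factorials to base \<open>q\<close>.  The idea is to sum over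
  \<open>n\<close> first, for a fixed \<open>m\<close>.  The series \<open>A\<^sub>m(t) = \<Sum>\<^sub>n h\<^sub>m\<^sub>+\<^sub>n t\<^sup>n / (q)\<^sub>n\<close> satisfy
  \<open>A\<^sub>m(t) - A\<^sub>m(tq) = t A\<^sub>m\<^sub>+\<^sub>1(t)\<close>, because \<open>(1 - q\<^sup>n) / (q)\<^sub>n = 1 / (q)\<^sub>n\<^sub>-\<^sub>1\<close>.  So all of them are
  determined by \<open>A\<^sub>0\<close>, which the \<open>q\<close>-binomial theorem evaluates as
  \<open>(ty)\<^sub>\<infinity> / ((t)\<^sub>\<infinity> (tx)\<^sub>\<infinity>)\<close>.  Put \<open>g\<^sub>k(t) = (tyq\<^sup>k)\<^sub>\<infinity> / ((tq\<^sup>k)\<^sub>\<infinity> (tx)\<^sub>\<infinity>)\<close>.  The contiguous relation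
  \<open>g\<^sub>k(t) - g\<^sub>k(tq) = t ((x - q\<^sup>k y) g\<^sub>k\<^sub>+\<^sub>1(t) + q\<^sup>k g\<^sub>k(t))\<close> (\<open>shifted_gf_diff\<close>) has exactly
  the shape of Pascal's rule for the \<open>q\<close>-binomial coefficients \<open>qbinom q m k\<close>, since
  \<open>P\<^sub>k (x - q\<^sup>k y) = P\<^sub>k\<^sub>+\<^sub>1\<close>.  Hence, by induction on \<open>m\<close>,
  \<open>A\<^sub>m(t) = \<Sum>\<^sub>k\<^sub>\<le>\<^sub>m qbinom q m k P\<^sub>k g\<^sub>k(t)\<close> (\<open>rogers_szego_shifted_sums\<close>).

  Summing this against \<open>s\<^sup>m / (q)\<^sub>m\<close> is a Cauchy product of the series \<open>\<Sum> s\<^sup>j / (q)\<^sub>j = 1 / (s)\<^sub>\<infinity>\<close>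
  with \<open>\<Sum>\<^sub>k P\<^sub>k g\<^sub>k(t) s\<^sup>k / (q)\<^sub>k\<close> (\<open>qbinom_convolution_sums\<close>), and the latter is the
  \<open>\<^sub>2\<phi>\<^sub>1\<close> series up to the factor \<open>g\<^sub>0(t)\<close>.

  The theorem takes the two sums in the opposite order.  The exchange is justified by absolute
  convergence: as \<open>A\<^sub>0\<close> converges at every \<open>1/\<rho>\<close> with \<open>\<rho> > max 1 \<bar>x\<bar>\<close>, the polynomials
  \<open>h\<^sub>N\<close> are \<open>O(\<rho>\<^sup>N)\<close> (\<open>rogers_szego_bound\<close>), and \<open>\<rho>\<close> can be chosen so that \<open>\<rho>s\<close> and \<open>\<rho>t\<close>
  still lie in the unit disc.
\<close>

section \<open>Infinite \<open>q\<close>-shifted factorials\<close>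

lemma qpoch_inf_step:
  assumes "norm q < 1"
  shows "qpoch_inf a q = (1 - a) * qpoch_inf (a * q) q"
  using qpoch_inf_split[OF assms, of a 1] by (simp add: qpoch_def)

lemma qpoch_inf_0 [simp]: "qpoch_inf 0 q = 1"
  by (simp add: qpoch_inf_def)

lemma norm_mult_power_less_1:
  fixes a q :: complex
  assumes "norm q < 1" "norm a < 1"
  shows "norm (a * q ^ k) < 1"
proof -
  have "norm a * norm q ^ k \<le> norm a"
    using assms by (intro mult_left_le power_le_one) auto
  with assms show ?thesis by (simp add: norm_mult norm_power)
qed

lemma one_minus_mult_power_nonzero:
  fixes a q :: complex
  assumes "norm q < 1" "norm a < 1"
  shows "1 - a * q ^ k \<noteq> 0"
  using norm_mult_power_less_1[OF assms, of k] by auto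

lemma qpoch_inf_nonzero:
  assumes "norm q < 1" "norm a < 1"
  shows "qpoch_inf a q \<noteq> 0"
  unfolding qpoch_inf_def
  by (intro prodinf_nonzero qpoch_inf_convergent one_minus_mult_power_nonzero assms)

lemma qpoch_nonzero:
  assumes "norm q < 1" "norm a < 1"
  shows "qpoch a q n \<noteq> 0"
  unfolding qpoch_def using one_minus_mult_power_nonzero[OF assms] by simp

lemma qpoch_tendsto_qpoch_inf:
  assumes "norm q < 1"
  shows "qpoch a q \<longlonglongrightarrow> qpoch_inf a q"
  using convergent_prod_LIMSEQ[OF qpoch_inf_convergent[OF assms, of a]]
  unfolding qpoch_def qpoch_inf_def by (simp add: LIMSEQ_lessThan_iff_atMost)

lemma qpoch_Suc: "qpoch a q (Suc n) = qpoch a q n * (1 - a * q ^ n)"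
  by (simp add: qpoch_def)

lemma qpoch_0 [simp]: "qpoch a q 0 = 1"
  by (simp add: qpoch_def)

lemma P_poly_Suc: "P_poly q (Suc k) x y = P_poly q k x y * (x - q ^ k * y)"
  by (simp add: P_poly_def)

lemma P_poly_0 [simp]: "P_poly q 0 x y = 1"
  by (simp add: P_poly_def)

section \<open>The \<open>q\<close>-binomial theorem\<close>

lemma P_poly_series_abs_summable:
  assumes q: "norm q < 1" and tx: "norm (t * x) < 1"
  shows "summable (\<lambda>k. norm (P_poly q k x y / qpoch q q k * t ^ k))"
proof -
  define r where "r k = (x - q ^ k * y) / (1 - q * q ^ k) * t" for k
  have "(\<lambda>k. q ^ k) \<longlonglongrightarrow> 0" using q by (rule LIMSEQ_power_zero)
  then have "r \<longlonglongrightarrow> (x - 0 * y) / (1 - q * 0) * t"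
    unfolding r_def using q by (intro tendsto_intros) auto
  then have "(\<lambda>k. norm (r k)) \<longlonglongrightarrow> norm (t * x)"
    using tendsto_norm by (fastforce simp: mult.commute)
  moreover obtain c where c: "norm (t * x) < c" "c < 1" using tx dense by blast
  ultimately have "eventually (\<lambda>k. norm (r k) < c) sequentially"
    by (simp add: order_tendsto_iff)
  then obtain N where N: "\<And>k. k \<ge> N \<Longrightarrow> norm (r k) < c"
    by (auto simp: eventually_sequentially)
  have step: "P_poly q (Suc k) x y / qpoch q q (Suc k) * t ^ Suc k
      = r k * (P_poly q k x y / qpoch q q k * t ^ k)" for k
    by (simp add: P_poly_Suc qpoch_Suc r_def mult_ac)
  show ?thesis
  proof (rule summable_ratio_test[OF c(2)])
    fix k assume "k \<ge> N"
    then show "norm (norm (P_poly q (Suc k) x y / qpoch q q (Suc k) * t ^ Suc k))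
        \<le> c * norm (norm (P_poly q k x y / qpoch q q k * t ^ k))"
      unfolding step norm_mult real_norm_def abs_norm_cancel abs_mult using N[of k] by (intro mult_right_mono) auto
  qed
qed

text \<open>
  Cauchy's classical argument: the sum \<open>f\<close> satisfies \<open>(1 - tx) f(t) = (1 - ty) f(tq)\<close>, and
  iterating this moves the argument to \<open>0\<close>, where \<open>f\<close> is continuous with value \<open>1\<close>.
\<close>

theorem q_binomial_theorem:
  assumes q: "norm q < 1" and tx: "norm (t * x) < 1"
  shows "(\<lambda>k. P_poly q k x y / qpoch q q k * t ^ k) sums
           (qpoch_inf (t * y) q / qpoch_inf (t * x) q)"
proof (cases "t = 0")
  case True
  have "(\<lambda>k. P_poly q k x y / qpoch q q k * t ^ k) sums (P_poly q 0 x y / qpoch q q 0)"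
    unfolding True by (rule powser_sums_zero[of "\<lambda>k. P_poly q k x y / qpoch q q k"])
  moreover have "P_poly q 0 x y / qpoch q q 0 = qpoch_inf (t * y) q / qpoch_inf (t * x) q"
    by (simp add: True)
  ultimately show ?thesis by (simp only:)
next
  case False
  define c where "c k = P_poly q k x y / qpoch q q k" for k
  define f where "f u = (\<Sum>k. c k * u ^ k)" for u
  have sums: "(\<lambda>k. c k * u ^ k) sums f u" if "norm (u * x) < 1" for u
    unfolding f_def c_def
    by (rule summable_sums, rule summable_norm_cancel, rule P_poly_series_abs_summable[OF q that])
  have c_Suc: "c (Suc k) * (1 - q ^ Suc k) = (x - q ^ k * y) * c k" for k
    using qpoch_self_nonzero[OF q, of k] one_minus_mult_power_nonzero[OF q q, of k]
    by (simp add: c_def P_poly_Suc qpoch_Suc field_simps)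
  have step: "(1 - u * x) * f u = (1 - u * y) * f (u * q)" if u: "norm (u * x) < 1" for u
  proof -
    have uq: "norm (u * q * x) < 1"
      using norm_mult_power_less_1[OF q u, of 1] by (simp add: mult_ac)
    have "(\<lambda>k. c k * u ^ k - c k * (u * q) ^ k) sums (f u - f (u * q))"
      by (intro sums_diff sums u uq)
    then have "(\<lambda>k. c (Suc k) * u ^ Suc k - c (Suc k) * (u * q) ^ Suc k) sums (f u - f (u * q))"
      by (subst sums_Suc_iff) simp
    moreover have "c (Suc k) * u ^ Suc k - c (Suc k) * (u * q) ^ Suc k
        = u * x * (c k * u ^ k) - u * y * (c k * (u * q) ^ k)" for k
    proof -
      have "c (Suc k) * u ^ Suc k - c (Suc k) * (u * q) ^ Suc k
          = c (Suc k) * (1 - q ^ Suc k) * u ^ Suc k"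
        by (simp add: power_mult_distrib algebra_simps)
      also have "\<dots> = u * x * (c k * u ^ k) - u * y * (c k * (u * q) ^ k)"
        unfolding c_Suc by (simp add: power_mult_distrib algebra_simps)
      finally show ?thesis .
    qed
    moreover have "(\<lambda>k. u * x * (c k * u ^ k) - u * y * (c k * (u * q) ^ k)) sums
        (u * x * f u - u * y * f (u * q))"
      by (intro sums_diff sums_mult sums u uq)
    ultimately have "f u - f (u * q) = u * x * f u - u * y * f (u * q)"
      by (simp add: sums_unique2)
    then show ?thesis by (simp add: algebra_simps)
  qed
  have iter: "qpoch (t * x) q n * f t = qpoch (t * y) q n * f (t * q ^ n)" for n
  proof (induction n)
    case (Suc n)
    have "norm (t * q ^ n * x) < 1"
      using norm_mult_power_less_1[OF q tx, of n] by (simp add: mult_ac)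
    from step[OF this] have st: "(1 - t * x * q ^ n) * f (t * q ^ n)
        = (1 - t * y * q ^ n) * f (t * q ^ Suc n)"
      by (simp add: mult_ac)
    have "qpoch (t * x) q (Suc n) * f t = (1 - t * x * q ^ n) * (qpoch (t * x) q n * f t)"
      by (simp add: qpoch_Suc)
    also have "\<dots> = qpoch (t * y) q n * ((1 - t * x * q ^ n) * f (t * q ^ n))"
      unfolding Suc.IH by simp
    also have "\<dots> = qpoch (t * y) q (Suc n) * f (t * q ^ Suc n)"
      unfolding st by (simp add: qpoch_Suc)
    finally show ?case .
  qed simp
  have "isCont f 0"
    unfolding f_def[abs_def] using sums[OF tx] False
    by (intro isCont_powser[of c t]) (auto simp: sums_iff)
  moreover have "(\<lambda>n. t * q ^ n) \<longlonglongrightarrow> 0"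
    using tendsto_mult_left[OF LIMSEQ_power_zero[OF q], of t] by simp
  ultimately have "(\<lambda>n. f (t * q ^ n)) \<longlonglongrightarrow> f 0"
    by (rule isCont_tendsto_compose)
  moreover have "f 0 = 1"
    using sums_unique[OF powser_sums_zero[of c]] by (simp add: f_def c_def)
  ultimately have "(\<lambda>n. qpoch (t * y) q n * f (t * q ^ n)) \<longlonglongrightarrow> qpoch_inf (t * y) q * 1"
    by (intro tendsto_mult qpoch_tendsto_qpoch_inf q) simp
  moreover have "(\<lambda>n. qpoch (t * x) q n * f t) \<longlonglongrightarrow> qpoch_inf (t * x) q * f t"
    by (intro tendsto_mult qpoch_tendsto_qpoch_inf q tendsto_const)
  ultimately have "qpoch_inf (t * x) q * f t = qpoch_inf (t * y) q"
    unfolding iter using LIMSEQ_unique by fastforce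
  then have "f t = qpoch_inf (t * y) q / qpoch_inf (t * x) q"
    using qpoch_inf_nonzero[OF q tx] by (simp add: field_simps)
  with sums[OF tx] show ?thesis by (simp add: c_def)
qed

text \<open>The case \<open>x = 1\<close>, \<open>y = 0\<close> of the \<open>q\<close>-binomial theorem is Euler's \<open>q\<close>-exponential series.\<close>

lemma q_exponential:
  assumes q: "norm q < 1" and t: "norm t < 1"
  shows "(\<lambda>k. t ^ k / qpoch q q k) sums (1 / qpoch_inf t q)"
    and "summable (\<lambda>k. norm (t ^ k / qpoch q q k))"
proof -
  have "P_poly q k 1 0 = 1" for k by (simp add: P_poly_def)
  with q_binomial_theorem[OF q, of t 1 0] P_poly_series_abs_summable[OF q, of t 1 0] t
  show "(\<lambda>k. t ^ k / qpoch q q k) sums (1 / qpoch_inf t q)"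
    and "summable (\<lambda>k. norm (t ^ k / qpoch q q k))"
    by simp_all
qed

section \<open>Sums with \<open>q\<close>-binomial coefficients\<close>

lemma qbinom_pascal:
  assumes q: "norm q < 1" and k: "k < m"
  shows "qbinom q (Suc m) (Suc k) = qbinom q m k + q ^ Suc k * qbinom q m (Suc k)"
proof -
  obtain d where m: "m = Suc (k + d)" using k less_imp_Suc_add by blast
  have nz: "qpoch q q k \<noteq> 0" "qpoch q q d \<noteq> 0" "1 - q * q ^ k \<noteq> 0" "1 - q * q ^ d \<noteq> 0"
    using qpoch_self_nonzero[OF q] one_minus_mult_power_nonzero[OF q q] by auto
  have diffs: "Suc m - Suc k = Suc d" "m - k = Suc d" "m - Suc k = d" by (simp_all add: m)
  have "1 - q * q ^ m = (1 - q * q ^ k) + q ^ Suc k * (1 - q * q ^ d)"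
    by (simp add: m power_add algebra_simps)
  then have "qbinom q (Suc m) (Suc k) = qpoch q q m * ((1 - q * q ^ k) + q ^ Suc k * (1 - q * q ^ d))
      / (qpoch q q k * (1 - q * q ^ k) * (qpoch q q d * (1 - q * q ^ d)))"
    by (simp only: qbinom_def qpoch_Suc[of q q m] diffs qpoch_Suc[of q q k] qpoch_Suc[of q q d])
  also have "\<dots> = qpoch q q m / (qpoch q q k * (qpoch q q d * (1 - q * q ^ d)))
      + q ^ Suc k * (qpoch q q m / (qpoch q q k * (1 - q * q ^ k) * qpoch q q d))"
    using nz by (simp add: divide_simps) (simp add: algebra_simps)
  also have "\<dots> = qbinom q m k + q ^ Suc k * qbinom q m (Suc k)"
    by (simp only: qbinom_def diffs qpoch_Suc[of q q k] qpoch_Suc[of q q d])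
  finally show ?thesis .
qed

lemma qbinom_ends:
  assumes "norm q < 1"
  shows "qbinom q n 0 = 1" "qbinom q n n = 1"
  using qpoch_self_nonzero[OF assms, of n] by (simp_all add: qbinom_def)

text \<open>
  Pascal's rule in summed form.  Only coefficients \<^term>\<open>qbinom q m k\<close> with \<open>k \<le> m\<close> occur here,
  so the spurious values of \<^const>\<open>qbinom\<close> above the diagonal stay out of the argument.
\<close>

lemma sum_qbinom_Suc:
  assumes q: "norm q < 1"
  shows "(\<Sum>k\<le>Suc m. qbinom q (Suc m) k * c k)
       = (\<Sum>k\<le>m. qbinom q m k * (c (Suc k) + q ^ k * c k))"
proof -
  have "(\<Sum>k\<le>Suc m. qbinom q (Suc m) k * c k)
      = c 0 + (\<Sum>k\<le>m. qbinom q (Suc m) (Suc k) * c (Suc k))"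
    by (subst sum.atMost_Suc_shift) (simp add: qbinom_ends[OF q])
  also have "(\<Sum>k\<le>m. qbinom q (Suc m) (Suc k) * c (Suc k))
      = (\<Sum>k<m. qbinom q (Suc m) (Suc k) * c (Suc k)) + c (Suc m)"
    by (simp add: lessThan_Suc_atMost[symmetric] qbinom_ends[OF q])
  also have "(\<Sum>k<m. qbinom q (Suc m) (Suc k) * c (Suc k))
      = (\<Sum>k<m. qbinom q m k * c (Suc k)) + (\<Sum>k<m. q ^ Suc k * qbinom q m (Suc k) * c (Suc k))"
    by (simp add: qbinom_pascal[OF q] sum.distrib[symmetric] algebra_simps)
  also have "c 0 + (\<dots> + c (Suc m))
      = ((\<Sum>k<m. qbinom q m k * c (Suc k)) + c (Suc m))
        + (c 0 + (\<Sum>k<m. q ^ Suc k * qbinom q m (Suc k) * c (Suc k)))"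
    by (simp only: add_ac)
  also have "(\<Sum>k<m. qbinom q m k * c (Suc k)) + c (Suc m) = (\<Sum>k\<le>m. qbinom q m k * c (Suc k))"
    by (simp add: lessThan_Suc_atMost[symmetric] qbinom_ends[OF q])
  also have "c 0 + (\<Sum>k<m. q ^ Suc k * qbinom q m (Suc k) * c (Suc k))
      = (\<Sum>k\<le>m. q ^ k * qbinom q m k * c k)"
    by (simp add: lessThan_Suc_atMost[symmetric] sum.lessThan_Suc_shift qbinom_ends[OF q]
             del: sum.lessThan_Suc)
  finally show ?thesis
    by (simp add: sum.distrib[symmetric] algebra_simps)
qed

text \<open>
  Dividing by \<open>(q)\<^sub>n\<close> turns a \<open>q\<close>-binomial sum into a convolution, so its \<open>q\<close>-exponential
  generating function is a Cauchy product, one factor being the \<open>q\<close>-exponential series.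
\<close>

lemma qbinom_convolution_sums:
  assumes q: "norm q < 1" and t: "norm t < 1"
    and a: "summable (\<lambda>k. norm (a k / qpoch q q k * t ^ k))"
      "(\<lambda>k. a k / qpoch q q k * t ^ k) sums A"
  shows "(\<lambda>n. (\<Sum>k\<le>n. qbinom q n k * a k) * (t ^ n / qpoch q q n)) sums (A / qpoch_inf t q)"
proof -
  have "(\<lambda>n. \<Sum>k\<le>n. (a k / qpoch q q k * t ^ k) * (t ^ (n - k) / qpoch q q (n - k)))
      sums (A * (1 / qpoch_inf t q))"
    using Cauchy_product_sums[OF a(1) q_exponential(2)[OF q t]]
      sums_unique[OF a(2)] sums_unique[OF q_exponential(1)[OF q t]] by simp
  moreover have "(\<Sum>k\<le>n. (a k / qpoch q q k * t ^ k) * (t ^ (n - k) / qpoch q q (n - k)))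
      = (\<Sum>k\<le>n. qbinom q n k * a k) * (t ^ n / qpoch q q n)" for n
    unfolding sum_distrib_right
  proof (rule sum.cong)
    fix k assume "k \<in> {..n}"
    then have "t ^ n = t ^ k * t ^ (n - k)" by (simp add: power_add[symmetric])
    then show "(a k / qpoch q q k * t ^ k) * (t ^ (n - k) / qpoch q q (n - k))
        = qbinom q n k * a k * (t ^ n / qpoch q q n)"
      using qpoch_self_nonzero[OF q] by (simp add: qbinom_def)
  qed simp
  ultimately show ?thesis by simp
qed

section \<open>Generating functions of shifted Rogers-Szego polynomials\<close>

text \<open>
  For \<open>k = 0\<close> this is the generating function of the \<open>h\<^sub>n\<close>.  For larger \<open>k\<close> the numerator and one
  denominator factor are moved \<open>k\<close> steps along the base, while \<open>(tx)\<^sub>\<infinity>\<close> stays in place: applying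
  the \<open>q\<close>-difference quotient in \<open>t\<close> repeatedly to the case \<open>k = 0\<close> yields combinations of
  exactly these functions.
\<close>

definition shifted_gf ::
  "complex \<Rightarrow> complex \<Rightarrow> complex \<Rightarrow> nat \<Rightarrow> complex \<Rightarrow> complex" where
  "shifted_gf q x y k t =
     qpoch_inf (t * y * q ^ k) q / (qpoch_inf (t * q ^ k) q * qpoch_inf (t * x) q)"

text \<open>
  After the common factor \<open>(tyq\<^sup>k\<^sup>+\<^sup>1)\<^sub>\<infinity> / ((tq\<^sup>k)\<^sub>\<infinity> (tx)\<^sub>\<infinity>)\<close> is removed, both sides become
  \<open>t (x + q\<^sup>k - tx q\<^sup>k - y q\<^sup>k)\<close>.
\<close>

lemma shifted_gf_diff:
  assumes q: "norm q < 1" and t: "norm t < 1" and tx: "norm (t * x) < 1"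
  shows "shifted_gf q x y k t - shifted_gf q x y k (t * q)
       = t * ((x - q ^ k * y) * shifted_gf q x y (Suc k) t + q ^ k * shifted_gf q x y k t)"
proof -
  define Y T X where "Y = qpoch_inf (t * y * q ^ Suc k) q"
    and "T = qpoch_inf (t * q ^ Suc k) q" and "X = qpoch_inf (t * x * q) q"
  have Y: "qpoch_inf (t * y * q ^ k) q = (1 - t * y * q ^ k) * Y"
    unfolding Y_def by (subst qpoch_inf_step[OF q]) (simp add: mult_ac)
  have T: "qpoch_inf (t * q ^ k) q = (1 - t * q ^ k) * T"
    unfolding T_def by (subst qpoch_inf_step[OF q]) (simp add: mult_ac)
  have X: "qpoch_inf (t * x) q = (1 - t * x) * X"
    unfolding X_def by (subst qpoch_inf_step[OF q]) (simp add: mult_ac)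
  have nz: "T \<noteq> 0" "X \<noteq> 0" "1 - t * q ^ k \<noteq> 0" "1 - t * x \<noteq> 0"
    using qpoch_inf_nonzero[OF q norm_mult_power_less_1[OF q t, of k]]
      qpoch_inf_nonzero[OF q tx] unfolding T X by auto
  have g0: "shifted_gf q x y k t = (1 - t * y * q ^ k) * Y / ((1 - t * q ^ k) * T * ((1 - t * x) * X))"
    by (simp only: shifted_gf_def Y T X)
  have g1: "shifted_gf q x y (Suc k) t = Y / (T * ((1 - t * x) * X))"
    by (simp only: shifted_gf_def Y_def T_def X)
  have gq: "shifted_gf q x y k (t * q) = Y / (T * X)"
    by (simp add: shifted_gf_def Y_def T_def X_def mult_ac)
  define U where "U = Y / (T * X * (1 - t * q ^ k) * (1 - t * x))"
  have gU: "shifted_gf q x y k t = (1 - t * y * q ^ k) * U"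
    "shifted_gf q x y (Suc k) t = (1 - t * q ^ k) * U"
    "shifted_gf q x y k (t * q) = (1 - t * q ^ k) * (1 - t * x) * U"
    using nz by (simp_all add: g0 g1 gq U_def)
  show ?thesis unfolding gU by (simp add: algebra_simps)
qed

theorem rogers_szego_sums:
  assumes q: "norm q < 1" and t: "norm t < 1" and tx: "norm (t * x) < 1"
  shows "(\<lambda>n. rogers_szego q n x y * (t ^ n / qpoch q q n)) sums
           (qpoch_inf (t * y) q / (qpoch_inf t q * qpoch_inf (t * x) q))"
  using qbinom_convolution_sums[OF q t P_poly_series_abs_summable[OF q tx]
      q_binomial_theorem[OF q tx], of y]
  by (simp add: rogers_szego_def mult_ac)

text \<open>
  The induction on \<open>m\<close> must vary \<open>t\<close>, since the step compares \<open>t\<close> with \<open>tq\<close>.  The resulting identity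
  is divided by \<open>t\<close>, so \<open>t = 0\<close> is treated apart: there both sides are \<open>h\<^sub>m\<close>.
\<close>

theorem rogers_szego_shifted_sums:
  assumes q: "norm q < 1" and t: "norm t < 1" and tx: "norm (t * x) < 1"
  shows "(\<lambda>n. rogers_szego q (m + n) x y * (t ^ n / qpoch q q n)) sums
           (\<Sum>k\<le>m. qbinom q m k * (P_poly q k x y * shifted_gf q x y k t))"
  using t tx
proof (induction m arbitrary: t)
  case 0
  then show ?case
    using rogers_szego_sums[OF q, of t x y]
    by (simp add: qbinom_ends[OF q] shifted_gf_def)
next
  case (Suc m)
  show ?case
  proof (cases "t = 0")
    case True
    have "(\<lambda>n. rogers_szego q (Suc m + n) x y / qpoch q q n * 0 ^ n) sums
        rogers_szego q (Suc m) x y"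
      using powser_sums_zero[of "\<lambda>n. rogers_szego q (Suc m + n) x y / qpoch q q n"] by simp
    then show ?thesis
      using True by (simp add: shifted_gf_def rogers_szego_def)
  next
    case False
    let ?h = "\<lambda>n. rogers_szego q n x y"
    let ?g = "\<lambda>k. shifted_gf q x y k"
    let ?P = "\<lambda>k. P_poly q k x y"
    have tq: "norm (t * q) < 1" and tqx: "norm (t * q * x) < 1"
      using norm_mult_power_less_1[OF q Suc.prems(1), of 1]
        norm_mult_power_less_1[OF q Suc.prems(2), of 1] by (simp_all add: mult_ac)
    let ?D = "\<lambda>n. ?h (m + n) * (t ^ n / qpoch q q n) - ?h (m + n) * ((t * q) ^ n / qpoch q q n)"
    have "?D sums ((\<Sum>k\<le>m. qbinom q m k * (?P k * ?g k t))
        - (\<Sum>k\<le>m. qbinom q m k * (?P k * ?g k (t * q))))"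
      by (intro sums_diff Suc.IH Suc.prems tq tqx)
    also have "(\<Sum>k\<le>m. qbinom q m k * (?P k * ?g k t))
        - (\<Sum>k\<le>m. qbinom q m k * (?P k * ?g k (t * q)))
        = (\<Sum>k\<le>m. qbinom q m k * (?P k * (?g k t - ?g k (t * q))))"
      by (simp add: sum_subtractf[symmetric] algebra_simps)
    also have "\<dots> = t * (\<Sum>k\<le>m. qbinom q m k *
        (?P (Suc k) * ?g (Suc k) t + q ^ k * (?P k * ?g k t)))"
      unfolding shifted_gf_diff[OF q Suc.prems] sum_distrib_left P_poly_Suc
      by (intro sum.cong) (simp_all add: algebra_simps)
    also have "\<dots> = t * (\<Sum>k\<le>Suc m. qbinom q (Suc m) k * (?P k * ?g k t))"
      by (simp only: sum_qbinom_Suc[OF q])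
    finally have "(\<lambda>n. ?D (Suc n)) sums
        (t * (\<Sum>k\<le>Suc m. qbinom q (Suc m) k * (?P k * ?g k t)))"
      by (subst sums_Suc_iff) simp
    moreover have "?D (Suc n) = t * (?h (Suc m + n) * (t ^ n / qpoch q q n))" for n
    proof -
      have "?D (Suc n) = ?h (m + Suc n) * t ^ Suc n * (1 - q * q ^ n) / qpoch q q (Suc n)"
        by (simp add: power_mult_distrib algebra_simps diff_divide_distrib)
      then show ?thesis
        using one_minus_mult_power_nonzero[OF q q, of n] by (simp add: qpoch_Suc)
    qed
    ultimately show ?thesis
      using False by (simp only: sums_mult_iff[OF False])
  qed
qed

section \<open>Exchanging the two summations\<close>

text \<open>
  At \<open>t = 1/\<rho>\<close> the generating function converges, so its terms are bounded; multiplying by the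
  bounded sequence \<open>(q)\<^sub>n\<close> leaves \<open>h\<^sub>n / \<rho>\<^sup>n\<close>.
\<close>

lemma rogers_szego_bound:
  fixes \<rho> :: real
  assumes q: "norm q < 1" and \<rho>: "1 < \<rho>" "norm x < \<rho>"
  obtains C where "0 \<le> C" "\<And>n. norm (rogers_szego q n x y) \<le> C * \<rho> ^ n"
proof -
  define u where "u = complex_of_real (1 / \<rho>)"
  have "norm u < 1" "norm (u * x) < 1"
    using \<rho> by (auto simp: u_def norm_mult norm_divide)
  from sums_summable[OF rogers_szego_sums[OF q this, of y]]
  have "Bseq (\<lambda>n. rogers_szego q n x y * (u ^ n / qpoch q q n))"
    by (rule summable_imp_Bseq)
  moreover have "Bseq (qpoch q q)"
    using qpoch_tendsto_qpoch_inf[OF q, of q] convergentI convergent_imp_Bseq by blast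
  ultimately have "Bseq (\<lambda>n. rogers_szego q n x y * (u ^ n / qpoch q q n) * qpoch q q n)"
    by (rule Bseq_mult)
  then obtain C where C: "0 < C"
    "\<And>n. norm (rogers_szego q n x y * (u ^ n / qpoch q q n) * qpoch q q n) \<le> C"
    by (auto simp: Bseq_def)
  have "norm (rogers_szego q n x y) \<le> C * \<rho> ^ n" for n
    using C(2)[of n] qpoch_self_nonzero[OF q, of n] \<rho>
    by (simp add: u_def norm_mult norm_power norm_divide field_simps)
  with C(1) show ?thesis by (intro that[of C]) auto
qed

text \<open>
  Fubini's theorem for sequential sums.  A product \<open>a n * b m\<close> is a convenient majorant because it is
  visibly summable over all pairs, which makes the family \<open>f\<close> summable independently of the order.
\<close>

lemma iterated_sums_swap:
  fixes f :: "nat \<Rightarrow> nat \<Rightarrow> complex" and a b :: "nat \<Rightarrow> real"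
  assumes a: "summable a" "\<And>n. 0 \<le> a n" and b: "summable b" "\<And>m. 0 \<le> b m"
    and bound: "\<And>n m. norm (f n m) \<le> a n * b m"
    and inner: "\<And>m. (\<lambda>n. f n m) sums g m" and outer: "g sums S"
  shows "(\<forall>n. summable (f n)) \<and> (\<lambda>n. \<Sum>m. f n m) sums S"
proof -
  let ?F = "\<lambda>(n, m). f n m"
  have hb: "(b has_sum suminf b) UNIV"
    using norm_summable_imp_has_sum[of b] b by (simp add: summable_sums)
  have "(\<lambda>(n, m). a n * b m) summable_on (UNIV \<times> UNIV)"
  proof (rule summable_on_SigmaI)
    show "((\<lambda>m. case (n, m) of (n, m) \<Rightarrow> a n * b m) has_sum a n * suminf b) UNIV" for n
      using has_sum_cmult_right[OF hb] by simp
    show "(\<lambda>n. a n * suminf b) summable_on UNIV"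
      using norm_summable_imp_summable_on[of a] a by (intro summable_on_cmult_left) simp
  qed (use a b in auto)
  then have "(\<lambda>p. norm (?F p)) summable_on (UNIV \<times> UNIV)"
    by (rule Infinite_Sum.abs_summable_on_comparison_test') (use bound in auto)
  then have "?F summable_on (UNIV \<times> UNIV)"
    by (rule abs_summable_summable)
  then obtain S' where S': "(?F has_sum S') (UNIV \<times> UNIV)"
    by (auto simp: summable_on_def)
  have nrows: "summable (\<lambda>m. norm (f n m))" for n
    by (rule summable_comparison_test'[of "\<lambda>m. a n * b m" 0])
      (use bound b in \<open>auto intro: summable_mult\<close>)
  have ncols: "summable (\<lambda>n. norm (f n m))" for m
    by (rule summable_comparison_test'[of "\<lambda>n. a n * b m" 0])
      (use bound a in \<open>auto intro: summable_mult2\<close>)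
  have rows: "summable (f n)" for n
    by (rule summable_norm_cancel[OF nrows])
  have "(g has_sum S') UNIV"
  proof (rule has_sum_SigmaD)
    show "((\<lambda>(m, n). ?F (n, m)) has_sum S') (UNIV \<times> UNIV)"
      using S' by (subst (asm) has_sum_swap)
    show "((\<lambda>n. case (m, n) of (m, n) \<Rightarrow> ?F (n, m)) has_sum g m) UNIV" for m
      using norm_summable_imp_has_sum[OF ncols inner] by simp
  qed
  then have "S' = S"
    using has_sum_imp_sums outer sums_unique2 by blast
  have "((\<lambda>n. \<Sum>m. f n m) has_sum S') UNIV"
  proof (rule has_sum_SigmaD[OF S'])
    show "((\<lambda>m. ?F (n, m)) has_sum (\<Sum>m. f n m)) UNIV" for n
      using norm_summable_imp_has_sum[OF nrows summable_sums[OF rows]] by simp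
  qed
  with rows \<open>S' = S\<close> show ?thesis by (blast intro: has_sum_imp_sums)
qed

section \<open>The double generating function\<close>

text \<open>
  The \<open>k\<close>-dependence of \<open>g\<^sub>k(t)\<close> is \<open>(t)\<^sub>k / (ty)\<^sub>k\<close>, and \<open>P\<^sub>k = x\<^sup>k (y/x)\<^sub>k\<close>; together they produce
  the terms of the \<open>\<^sub>2\<phi>\<^sub>1\<close> series.
\<close>

lemma shifted_gf_term_eq_phi21_term:
  assumes q: "norm q < 1" and t: "norm t < 1" and x: "x \<noteq> 0" and nz: "qpoch (t * y) q k \<noteq> 0"
  shows "P_poly q k x y * shifted_gf q x y k t / qpoch q q k * s ^ k
       = qpoch_inf (t * y) q / (qpoch_inf t q * qpoch_inf (t * x) q)
           * phi21_term t (y / x) (t * y) q (s * x) k"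
proof -
  have "qpoch_inf (t * q ^ k) q \<noteq> 0"
    by (intro qpoch_inf_nonzero norm_mult_power_less_1 q t)
  then show ?thesis
    using nz qpoch_nonzero[OF q t, of k]
    by (simp add: qpoch_inf_split[OF q, of t k] qpoch_inf_split[OF q, of "t * y" k]
        shifted_gf_def phi21_term_def P_poly_eq_qpoch[OF x] power_mult_distrib field_simps)
qed

lemma phi21_term_abs_summable:
  assumes q: "norm q < 1" and z: "norm z < 1" and nz: "\<And>k. qpoch b1 q k \<noteq> 0"
  shows "summable (\<lambda>k. norm (phi21_term a1 a2 b1 q z k))"
proof -
  obtain r where r: "norm z < r" "r < 1" using z dense by blast
  then have "0 < r" using norm_ge_zero[of z] by linarith
  then have nr: "norm (complex_of_real r) = r" by simp
  have "summable (phi21_term a1 a2 b1 q (of_real r))"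
    using r nr by (intro summable_phi21_term q nz) simp
  then show ?thesis
    unfolding phi21_term_def[abs_def] using r nr by (intro powser_insidea) auto
qed

theorem theorem5p4:
  fixes q x y s t :: complex
  assumes "norm q < 1"
    and "Max {norm s, norm t, norm (s * x), norm (t * x)} < 1"
    and "x \<noteq> 0"
    and "\<And>k. qpoch (t * y) q k \<noteq> 0"
  shows "(\<forall>n. summable (\<lambda>m.
            rogers_szego q (m + n) x y * (t ^ n / qpoch q q n) * (s ^ m / qpoch q q m))) \<and>
         (\<lambda>n. \<Sum>m.
            rogers_szego q (m + n) x y * (t ^ n / qpoch q q n) * (s ^ m / qpoch q q m))
         sums
         (qpoch_inf (t * y) q / (qpoch_inf s q * qpoch_inf t q * qpoch_inf (t * x) q)
            * phi21 t (y / x) (t * y) q (s * x))"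
proof -
  note q = assms(1) and x = assms(3) and nz = assms(4)
  have s: "norm s < 1" and t: "norm t < 1" and sx: "norm (s * x) < 1" and tx: "norm (t * x) < 1"
    using assms(2) by simp_all
  define G where "G = qpoch_inf (t * y) q / (qpoch_inf t q * qpoch_inf (t * x) q)"
  let ?a = "\<lambda>k. P_poly q k x y * shifted_gf q x y k t"

  have terms: "?a k / qpoch q q k * s ^ k = G * phi21_term t (y / x) (t * y) q (s * x) k" for k
    unfolding G_def by (rule shifted_gf_term_eq_phi21_term[OF q t x nz])
  have "summable (\<lambda>k. norm (?a k / qpoch q q k * s ^ k))"
    unfolding terms norm_mult by (intro summable_mult phi21_term_abs_summable q sx nz)
  moreover have "(\<lambda>k. ?a k / qpoch q q k * s ^ k) sums (G * phi21 t (y / x) (t * y) q (s * x))"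
    unfolding terms phi21_def
    by (intro sums_mult summable_sums summable_phi21_term q sx nz)
  ultimately have outer: "(\<lambda>m. (\<Sum>k\<le>m. qbinom q m k * ?a k) * (s ^ m / qpoch q q m)) sums
      (G * phi21 t (y / x) (t * y) q (s * x) / qpoch_inf s q)"
    by (rule qbinom_convolution_sums[OF q s])

  \<comment> \<open>With \<open>w = max 1 \<bar>x\<bar> * max \<bar>s\<bar> \<bar>t\<bar> < 1\<close>, the radius \<open>\<rho> = 2 max 1 \<bar>x\<bar> / (1 + w)\<close> exceeds
    \<open>max 1 \<bar>x\<bar>\<close>, while \<open>\<rho> max \<bar>s\<bar> \<bar>t\<bar> = 2w / (1 + w) < 1\<close>.\<close>
  define M where "M = max 1 (norm x)"
  define w where "w = M * max (norm s) (norm t)"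
  define \<rho> where "\<rho> = 2 * M / (1 + w)"
  have w: "0 \<le> w" "w < 1"
    using s t sx tx by (auto simp: w_def M_def max_def norm_mult mult.commute)
  have M: "1 \<le> M" "norm x \<le> M" by (auto simp: M_def)
  have "M < \<rho>" using w M by (simp add: \<rho>_def field_simps)
  then have \<rho>: "1 < \<rho>" "norm x < \<rho>" using M by linarith+
  have "\<rho> * max (norm s) (norm t) = 2 * w / (1 + w)" by (simp add: \<rho>_def w_def)
  also have "\<dots> < 1" using w by (simp add: field_simps)
  finally have rmax: "\<rho> * max (norm s) (norm t) < 1" .
  have "\<rho> * norm s \<le> \<rho> * max (norm s) (norm t)" "\<rho> * norm t \<le> \<rho> * max (norm s) (norm t)"
    using \<rho> by (intro mult_left_mono; simp)+
  then have "\<rho> * norm s < 1" "\<rho> * norm t < 1" using rmax by (meson le_less_trans)+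
  then have \<rho>s: "norm (of_real \<rho> * s) < 1" and \<rho>t: "norm (of_real \<rho> * t) < 1"
    using \<rho> by (simp_all add: norm_mult)
  obtain C where C: "0 \<le> C" "\<And>n. norm (rogers_szego q n x y) \<le> C * \<rho> ^ n"
    using rogers_szego_bound[OF q \<rho>] by blast

  have "(\<forall>n. summable (\<lambda>m.
            rogers_szego q (m + n) x y * (t ^ n / qpoch q q n) * (s ^ m / qpoch q q m))) \<and>
        (\<lambda>n. \<Sum>m. rogers_szego q (m + n) x y * (t ^ n / qpoch q q n) * (s ^ m / qpoch q q m))
          sums (G * phi21 t (y / x) (t * y) q (s * x) / qpoch_inf s q)"
  proof (rule iterated_sums_swap[OF _ _ _ _ _ _ outer])
    show "summable (\<lambda>n. C * norm ((of_real \<rho> * t) ^ n / qpoch q q n))"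
      by (intro summable_mult q_exponential(2) q \<rho>t)
    show "summable (\<lambda>m. norm ((of_real \<rho> * s) ^ m / qpoch q q m))"
      by (intro q_exponential(2) q \<rho>s)
    show "norm (rogers_szego q (m + n) x y * (t ^ n / qpoch q q n) * (s ^ m / qpoch q q m))
        \<le> C * norm ((of_real \<rho> * t) ^ n / qpoch q q n)
            * norm ((of_real \<rho> * s) ^ m / qpoch q q m)" for n m
    proof -
      have "norm (rogers_szego q (m + n) x y * (t ^ n / qpoch q q n) * (s ^ m / qpoch q q m))
          = norm (rogers_szego q (m + n) x y)
            * (norm (t ^ n / qpoch q q n) * norm (s ^ m / qpoch q q m))"
        by (simp only: norm_mult mult.assoc)
      also have "\<dots> \<le> C * \<rho> ^ (m + n)
            * (norm (t ^ n / qpoch q q n) * norm (s ^ m / qpoch q q m))"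
        by (intro mult_right_mono C) simp
      also have "\<dots> = C * norm ((of_real \<rho> * t) ^ n / qpoch q q n)
            * norm ((of_real \<rho> * s) ^ m / qpoch q q m)"
        using \<rho> by (simp add: norm_mult norm_divide norm_power power_mult_distrib power_add)
      finally show ?thesis .
    qed
    show "(\<lambda>n. rogers_szego q (m + n) x y * (t ^ n / qpoch q q n) * (s ^ m / qpoch q q m)) sums
        ((\<Sum>k\<le>m. qbinom q m k * ?a k) * (s ^ m / qpoch q q m))" for m
      by (intro sums_mult2 rogers_szego_shifted_sums q t tx)
  qed (use C in auto)
  moreover have "G * phi21 t (y / x) (t * y) q (s * x) / qpoch_inf s q
      = qpoch_inf (t * y) q / (qpoch_inf s q * qpoch_inf t q * qpoch_inf (t * x) q)
          * phi21 t (y / x) (t * y) q (s * x)"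
    by (simp add: G_def mult_ac)
  ultimately show ?thesis by simp
qed

end
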